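(* Let $0<\varepsilon<1$ and let $G$ be a finite graph. Then $G$ has a unit grid intersection representation in which every segment is contained in an open axis-parallel square of side length $1+\varepsilon$ if and only if $G$ is an orthogonal ray graph.
   Context: A grid intersection representation of a bipartite graph $G$ with bipartition $(H,V)$ assigns to each vertex of $H$ a horizontal closed line segment and to each vertex of $V$ a vertical closed line segment in the plane, such that no two horizontal segments intersect, no two vertical segments intersect, and for $u\in H$, $v\in V$ the segments of $u$ and $v$ intersect if and only if $uv\in E(G)$. It is a unit grid intersection representation if all segments have length $1$; graphs admitting one are unit grid intersection graphs (UGIGs). An orthogonal ray graph is a bipartite graph admitting a representation of the same kind in which the horizontal and vertical segments are replaced by horizontal and vertical closed rays (half-lines), each ray pointing in any of the two directions along its axis. *)

theory Defs
  imports "HOL-Analysis.Analysis" "Graph_Theory.Digraph"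
begin

text \<open>
  A finite simple graph is a symmetric loop-free digraph without multiple arcs, as in the locale
  \<^locale>\<open>graph\<close>; adjacency is \<open>u \<rightarrow>\<^bsub>G\<^esub> v\<close>. The plane is \<^typ>\<open>real \<times> real\<close>.
\<close>

definition bipartition :: "('a, 'b) pre_digraph \<Rightarrow> 'a set \<Rightarrow> 'a set \<Rightarrow> bool" where
  "bipartition G H V \<longleftrightarrow>
     H \<union> V = verts G \<and> H \<inter> V = {} \<and>
     (\<forall>u v. u \<rightarrow>\<^bsub>G\<^esub> v \<longrightarrow> (u \<in> H \<and> v \<in> V) \<or> (u \<in> V \<and> v \<in> H))"

definition horizontal_segment :: "(real \<times> real) set \<Rightarrow> bool" where
  "horizontal_segment S \<longleftrightarrow> (\<exists>a b y. a < b \<and> S = closed_segment (a, y) (b, y))"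

definition vertical_segment :: "(real \<times> real) set \<Rightarrow> bool" where
  "vertical_segment S \<longleftrightarrow> (\<exists>x a b. a < b \<and> S = closed_segment (x, a) (x, b))"

definition unit_segment :: "(real \<times> real) set \<Rightarrow> bool" where
  "unit_segment S \<longleftrightarrow> (\<exists>p q. S = closed_segment p q \<and> dist p q = 1)"

definition horizontal_ray :: "(real \<times> real) set \<Rightarrow> bool" where
  "horizontal_ray S \<longleftrightarrow> (\<exists>a y. S = {a..} \<times> {y} \<or> S = {..a} \<times> {y})"

definition vertical_ray :: "(real \<times> real) set \<Rightarrow> bool" where
  "vertical_ray S \<longleftrightarrow> (\<exists>x a. S = {x} \<times> {a..} \<or> S = {x} \<times> {..a})"

text \<open>
  The part common to segment and ray representations: \<open>hor\<close> and \<open>ver\<close> are the predicates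
  specifying the admissible horizontal and vertical objects.
\<close>

definition bipartite_intersection_rep ::
  "((real \<times> real) set \<Rightarrow> bool) \<Rightarrow> ((real \<times> real) set \<Rightarrow> bool) \<Rightarrow>
   ('a, 'b) pre_digraph \<Rightarrow> 'a set \<Rightarrow> 'a set \<Rightarrow> ('a \<Rightarrow> (real \<times> real) set) \<Rightarrow> bool" where
  "bipartite_intersection_rep hor ver G H V S \<longleftrightarrow>
     bipartition G H V \<and>
     (\<forall>u\<in>H. hor (S u)) \<and> (\<forall>v\<in>V. ver (S v)) \<and>
     disjoint_family_on S H \<and> disjoint_family_on S V \<and>
     (\<forall>u\<in>H. \<forall>v\<in>V. S u \<inter> S v \<noteq> {} \<longleftrightarrow> u \<rightarrow>\<^bsub>G\<^esub> v)"

definition grid_intersection_rep ::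
  "('a, 'b) pre_digraph \<Rightarrow> 'a set \<Rightarrow> 'a set \<Rightarrow> ('a \<Rightarrow> (real \<times> real) set) \<Rightarrow> bool" where
  "grid_intersection_rep = bipartite_intersection_rep horizontal_segment vertical_segment"

definition unit_grid_intersection_rep ::
  "('a, 'b) pre_digraph \<Rightarrow> 'a set \<Rightarrow> 'a set \<Rightarrow> ('a \<Rightarrow> (real \<times> real) set) \<Rightarrow> bool" where
  "unit_grid_intersection_rep G H V S \<longleftrightarrow>
     grid_intersection_rep G H V S \<and> (\<forall>v\<in>verts G. unit_segment (S v))"

definition orthogonal_ray_graph :: "('a, 'b) pre_digraph \<Rightarrow> bool" where
  "orthogonal_ray_graph G \<longleftrightarrow>
     (\<exists>H V S. bipartite_intersection_rep horizontal_ray vertical_ray G H V S)"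

definition open_square :: "real \<times> real \<Rightarrow> real \<Rightarrow> (real \<times> real) set" where
  "open_square c s = {fst c <..< fst c + s} \<times> {snd c <..< snd c + s}"

end

theory Submission
  imports Defs
begin

text \<open>
  Put the open square at the origin. A horizontal segment \<open>[a, a + 1] \<times> {y}\<close> inside it has
  \<open>0 < a < \<epsilon>\<close>, so of the two conditions \<open>a \<le> x \<le> a + 1\<close> for meeting a vertical segment at
  abscissa \<open>x\<close> only \<open>a \<le> x\<close> matters if \<open>x \<le> 1\<close>, and only \<open>x - 1 \<le> a\<close> if \<open>x > 1\<close>: the direction
  of the inequality is chosen by the vertical segment. For a ray representation it is the inequality
  between ordinates whose direction is chosen by the vertical ray. Hence exchanging the two axes
  turns one kind of representation into the other: the horizontal segment becomes a ray at height
  \<open>a\<close> with end point \<open>y\<close> or \<open>y - 1\<close>, and symmetrically for vertical segments. The exchange may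
  destroy disjointness within a class, so first all coordinates are moved to general position.
\<close>

section \<open>Order comparisons and general position\<close>

definition dir_le :: "bool \<Rightarrow> real \<Rightarrow> real \<Rightarrow> bool" where
  "dir_le d s t \<longleftrightarrow> (if d then s \<le> t else t \<le> s)"

text \<open>Each strict inequality survives for all sufficiently small \<delta> by continuity, and
  finitely many of them admit a common \<delta>.\<close>

lemma finite_perturbation_preserves_less:
  fixes f g :: "'i \<Rightarrow> real"
  assumes "finite I"
  shows "\<exists>\<delta>>0. \<forall>i\<in>I. \<forall>j\<in>I. f i < f j \<longrightarrow> f i + \<delta> * g i < f j + \<delta> * g j"
proof -
  have "\<forall>\<^sub>F \<delta> in at_right 0. f i < f j \<longrightarrow> f i + \<delta> * g i < f j + \<delta> * g j" for i j
  proof (cases "f i < f j")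
    case True
    have "((\<lambda>\<delta>. f j + \<delta> * g j - (f i + \<delta> * g i)) \<longlongrightarrow> f j + 0 * g j - (f i + 0 * g i)) (at_right 0)"
      by (intro tendsto_intros)
    from order_tendstoD(1)[OF this, of 0] True show ?thesis
      by (auto elim: eventually_mono)
  qed simp
  then have "\<forall>\<^sub>F \<delta> in at_right 0. \<forall>i\<in>I. \<forall>j\<in>I. f i < f j \<longrightarrow> f i + \<delta> * g i < f j + \<delta> * g j"
    using assms by (simp add: eventually_ball_finite)
  with eventually_at_right_less[of "0::real"]
  have "\<forall>\<^sub>F \<delta> in at_right 0. 0 < \<delta> \<and> (\<forall>i\<in>I. \<forall>j\<in>I. f i < f j \<longrightarrow> f i + \<delta> * g i < f j + \<delta> * g j)"
    by eventually_elim blast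
  then show ?thesis
    by (rule eventually_happens'[OF trivial_limit_at_right_real])
qed

text \<open>All comparisons with \<open>v\<close> have the same direction \<open>d v\<close>, so
  moving \<open>x v\<close> slightly in the favourable direction keeps every comparison that held
  with equality. Small distinct offsets then give injectivity, and an increasing map squeezes all
  values into the short interval.\<close>

lemma dir_le_general_position:
  fixes a :: "'a \<Rightarrow> real" and x :: "'b \<Rightarrow> real" and d :: "'b \<Rightarrow> bool"
  assumes "finite A" "finite B" "0 < \<epsilon>"
  obtains a' x' where "inj_on a' A" "inj_on x' B" "a' \<in> A \<rightarrow> {0<..<\<epsilon>}" "x' \<in> B \<rightarrow> {0<..<\<epsilon>}"
    "\<forall>u\<in>A. \<forall>v\<in>B. dir_le (d v) (a' u) (x' v) \<longleftrightarrow> dir_le (d v) (a u) (x v)"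
proof -
  define I where "I = A <+> B"
  have fin: "finite I"
    using assms by (simp add: I_def)
  obtain n :: "'a + 'b \<Rightarrow> nat" where n: "inj_on n I"
    using finite_imp_inj_to_nat_seg[OF fin] by blast
  \<comment> \<open>Distinct offsets; the summand 2 keeps them strictly below 1 even where
    \<open>n\<close> is 0, so a shift by 1 or -1 always outweighs them.\<close>
  define h where "h i = 1 / (real (n i) + 2)" for i
  have h01: "0 < h i" "h i < 1" for i
    by (auto simp: h_def field_simps)
  have h_inj: "h i = h j \<Longrightarrow> i \<in> I \<Longrightarrow> j \<in> I \<Longrightarrow> i = j" for i j
    using n by (auto simp: h_def inj_on_def field_simps)
  define f where "f = case_sum a x"
  \<comment> \<open>The shift by \<open>\<plusminus>1\<close> makes the weak inequalities strict before ties are broken by \<open>h\<close>.\<close>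
  define g where "g i = h i + case_sum (\<lambda>_. 0) (\<lambda>v. if d v then 1 else -1) i" for i
  obtain \<delta> where \<delta>: "\<delta> > 0"
    and less: "\<And>i j. i \<in> I \<Longrightarrow> j \<in> I \<Longrightarrow> f i < f j \<Longrightarrow> f i + \<delta> * g i < f j + \<delta> * g j"
    using finite_perturbation_preserves_less[OF fin, of f g] by blast
  define k where "k i = f i + \<delta> * g i" for i
  \<comment> \<open>A tie of perturbed values forces \<open>f i = f j\<close>, since strict
    inequalities survive; what remains is divided by \<delta>.\<close>
  have k_eq: "g i = g j" if "k i = k j" "i \<in> I" "j \<in> I" for i j
    using less[of i j] less[of j i] that \<delta> unfolding k_def
    by (cases "f i" "f j" rule: linorder_cases) auto
  \<comment> \<open>An increasing bijection from the real line onto the open interval from 0 to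
    \<epsilon>.\<close>
  define s :: "real \<Rightarrow> real" where "s t = \<epsilon> * (1/2 + arctan t / pi)" for t
  have s_le: "s t \<le> s t' \<longleftrightarrow> t \<le> t'" for t t'
    using \<open>0 < \<epsilon>\<close> by (simp add: s_def divide_le_cancel arctan_le_iff)
  have s_eq: "s t = s t' \<longleftrightarrow> t = t'" for t t'
    using s_le[of t t'] s_le[of t' t] by (metis order_antisym order_refl)
  have s_range: "s t \<in> {0<..<\<epsilon>}" for t
  proof -
    have "0 < 1/2 + arctan t / pi" "1/2 + arctan t / pi < 1"
      using arctan_lbound[of t] arctan_ubound[of t] by (simp_all add: field_simps)
    then show ?thesis
      using \<open>0 < \<epsilon>\<close> by (auto simp: s_def)
  qed
  show ?thesis
  proof
    show "inj_on (\<lambda>u. s (k (Inl u))) A"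
    proof (rule inj_onI)
      fix u u' assume "u \<in> A" "u' \<in> A" "s (k (Inl u)) = s (k (Inl u'))"
      then show "u = u'"
        using k_eq[of "Inl u" "Inl u'"] h_inj[of "Inl u" "Inl u'"]
        by (auto simp: s_eq I_def g_def)
    qed
    show "inj_on (\<lambda>v. s (k (Inr v))) B"
    proof (rule inj_onI)
      fix v v' assume "v \<in> B" "v' \<in> B" "s (k (Inr v)) = s (k (Inr v'))"
      then have I: "Inr v \<in> I" "Inr v' \<in> I" and "g (Inr v) = g (Inr v')"
        using k_eq[of "Inr v" "Inr v'"] by (auto simp: s_eq I_def)
      \<comment> \<open>On \<open>B\<close> the values of \<open>g\<close> lie between 1 and 2 or
        between -1 and 0, depending on \<open>d\<close>; equal values thus carry the same
        shift.\<close>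
      then have "h (Inr v) = h (Inr v')"
        using h01[of "Inr v"] h01[of "Inr v'"] by (simp add: g_def split: if_splits)
      then show "v = v'"
        using h_inj I by blast
    qed
    show "\<forall>u\<in>A. \<forall>v\<in>B. dir_le (d v) (s (k (Inl u))) (s (k (Inr v))) \<longleftrightarrow> dir_le (d v) (a u) (x v)"
    proof (intro ballI)
      fix u v assume "u \<in> A" "v \<in> B"
      then have I: "Inl u \<in> I" "Inr v \<in> I"
        by (auto simp: I_def)
      show "dir_le (d v) (s (k (Inl u))) (s (k (Inr v))) \<longleftrightarrow> dir_le (d v) (a u) (x v)"
      proof (cases "a u" "x v" rule: linorder_cases)
        case equal
        have "g (Inl u) \<le> g (Inr v) \<longleftrightarrow> d v" "g (Inr v) \<le> g (Inl u) \<longleftrightarrow> \<not> d v"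
          using h01[of "Inl u"] h01[of "Inr v"] by (auto simp: g_def)
        with equal \<delta> show ?thesis
          by (auto simp: dir_le_def s_le k_def f_def)
      qed (use less[OF I] less[OF I(2) I(1)] in \<open>auto simp: dir_le_def s_le k_def f_def\<close>)
    qed
  qed (use s_range in auto)
qed

text \<open>
  For segments, \<open>a\<close> and \<open>b\<close> are
  the left and lower ends and \<open>x\<close>, \<open>y\<close> the fixed coordinates modulo 1; for rays, \<open>a\<close> and \<open>b\<close> are
  the fixed coordinates and \<open>x\<close>, \<open>y\<close> the end points.
\<close>

definition order_rep where
  "order_rep G H V a x d y b e \<longleftrightarrow>
     (\<forall>u\<in>H. \<forall>v\<in>V. u \<rightarrow>\<^bsub>G\<^esub> v \<longleftrightarrow> dir_le (d v) (a u) (x v) \<and> dir_le (e u) (b v) (y u))"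

text \<open>The two conditions share no coordinates, so the pairs \<open>a\<close>, \<open>x\<close>
  and \<open>b\<close>, \<open>y\<close> are moved independently, with \<open>H\<close> and
  \<open>V\<close> exchanged for the second pair.\<close>

lemma order_rep_general_position:
  assumes "order_rep G H V a x d y b e" "finite H" "finite V" "0 < \<epsilon>"
  obtains a' x' y' b' where "order_rep G H V a' x' d y' b' e"
    "inj_on a' H" "inj_on x' V" "inj_on y' H" "inj_on b' V"
    "a' \<in> H \<rightarrow> {0<..<\<epsilon>}" "x' \<in> V \<rightarrow> {0<..<\<epsilon>}" "y' \<in> H \<rightarrow> {0<..<\<epsilon>}" "b' \<in> V \<rightarrow> {0<..<\<epsilon>}"
proof -
  obtain a' x' where 1: "inj_on a' H" "inj_on x' V" "a' \<in> H \<rightarrow> {0<..<\<epsilon>}" "x' \<in> V \<rightarrow> {0<..<\<epsilon>}"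
    "\<forall>u\<in>H. \<forall>v\<in>V. dir_le (d v) (a' u) (x' v) \<longleftrightarrow> dir_le (d v) (a u) (x v)"
    by (rule dir_le_general_position[OF assms(2-4)])
  obtain b' y' where 2: "inj_on b' V" "inj_on y' H" "b' \<in> V \<rightarrow> {0<..<\<epsilon>}" "y' \<in> H \<rightarrow> {0<..<\<epsilon>}"
    "\<forall>v\<in>V. \<forall>u\<in>H. dir_le (e u) (b' v) (y' u) \<longleftrightarrow> dir_le (e u) (b v) (y u)"
    by (rule dir_le_general_position[OF assms(3,2,4)])
  show ?thesis
    by (rule that[of a' x' y' b'])
      (use assms(1) 1 2 in \<open>simp_all add: order_rep_def\<close>)
qed

section \<open>Unit segments in coordinates\<close>

lemma closed_segment_horizontal:
  fixes p q y :: real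
  assumes "p \<le> q"
  shows "closed_segment (p, y) (q, y) = {p..q} \<times> {y}"
proof -
  have "closed_segment (p, y) (q, y) = (\<lambda>t. (t, y)) ` closed_segment p q"
    by (force simp: closed_segment_def algebra_simps)
  then show ?thesis
    using assms by (auto simp: closed_segment_eq_real_ivl)
qed

lemma closed_segment_vertical:
  fixes p q x :: real
  assumes "p \<le> q"
  shows "closed_segment (x, p) (x, q) = {x} \<times> {p..q}"
proof -
  have "closed_segment (x, p) (x, q) = (\<lambda>t. (x, t)) ` closed_segment p q"
    by (force simp: closed_segment_def algebra_simps)
  then show ?thesis
    using assms by (auto simp: closed_segment_eq_real_ivl)
qed

text \<open>A segment determines its end points up to order. Hence the end points witnessing the
  orientation and those witnessing unit length give the same length.\<close>

lemma dist_eq_if_closed_segment_eq: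
  fixes a b p q :: "'a::euclidean_space"
  assumes "closed_segment a b = closed_segment p q"
  shows "dist a b = dist p q"
  using assms by (metis closed_segment_eq doubleton_eq_iff dist_commute)

lemma horizontal_unit_segment_iff:
  "horizontal_segment S \<and> unit_segment S \<longleftrightarrow> (\<exists>a y. S = {a..a + 1} \<times> {y})"
proof
  assume S: "horizontal_segment S \<and> unit_segment S"
  then obtain a b y where ab: "a < b" "S = closed_segment (a, y) (b, y)"
    by (auto simp: horizontal_segment_def)
  with S have "dist (a, y) (b, y) = 1"
    by (metis unit_segment_def dist_eq_if_closed_segment_eq)
  with ab(1) have "b = a + 1"
    by (simp add: dist_Pair_Pair dist_real_def)
  with ab show "\<exists>a y. S = {a..a + 1} \<times> {y}"
    by (auto simp: closed_segment_horizontal)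
next
  assume "\<exists>a y. S = {a..a + 1} \<times> {y}"
  then obtain a y where "S = closed_segment (a, y) (a + 1, y)"
    by (auto simp: closed_segment_horizontal)
  moreover have "dist (a, y) (a + 1, y) = 1"
    by (simp add: dist_Pair_Pair dist_real_def)
  ultimately show "horizontal_segment S \<and> unit_segment S"
    unfolding horizontal_segment_def unit_segment_def
    by (metis less_add_one)
qed

lemma vertical_unit_segment_iff:
  "vertical_segment S \<and> unit_segment S \<longleftrightarrow> (\<exists>x b. S = {x} \<times> {b..b + 1})"
proof
  assume S: "vertical_segment S \<and> unit_segment S"
  then obtain a b x where ab: "a < b" "S = closed_segment (x, a) (x, b)"
    by (auto simp: vertical_segment_def)
  with S have "dist (x, a) (x, b) = 1"
    by (metis unit_segment_def dist_eq_if_closed_segment_eq)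
  with ab(1) have "b = a + 1"
    by (simp add: dist_Pair_Pair dist_real_def)
  with ab show "\<exists>x b. S = {x} \<times> {b..b + 1}"
    by (auto simp: closed_segment_vertical)
next
  assume "\<exists>x b. S = {x} \<times> {b..b + 1}"
  then obtain b x where "S = closed_segment (x, b) (x, b + 1)"
    by (auto simp: closed_segment_vertical)
  moreover have "dist (x, b) (x, b + 1) = 1"
    by (simp add: dist_Pair_Pair dist_real_def)
  ultimately show "vertical_segment S \<and> unit_segment S"
    unfolding vertical_segment_def unit_segment_def
    by (metis less_add_one)
qed

lemma unit_grid_intersection_rep_iff:
  "unit_grid_intersection_rep G H V S \<longleftrightarrow>
     bipartite_intersection_rep (\<lambda>S. \<exists>a y. S = {a..a + 1} \<times> {y}) (\<lambda>S. \<exists>x b. S = {x} \<times> {b..b + 1}) G H V S"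
proof -
  have "H \<union> V = verts G" if "bipartition G H V"
    using that by (simp add: bipartition_def)
  then show ?thesis
    unfolding unit_grid_intersection_rep_def grid_intersection_rep_def bipartite_intersection_rep_def
      horizontal_unit_segment_iff[symmetric] vertical_unit_segment_iff[symmetric]
    by blast
qed

section \<open>Unit segments in a small square versus order representations\<close>

lemma order_rep_if_unit_grid_intersection_rep:
  assumes rep: "unit_grid_intersection_rep G H V S" and "\<epsilon> < 1"
    and sq: "\<forall>v\<in>verts G. S v \<subseteq> open_square c (1 + \<epsilon>)"
  shows "\<exists>a x d y b e. order_rep G H V a x d y b e"
proof -
  obtain c1 c2 where c: "c = (c1, c2)"
    by (cases c)
  have bip: "bipartite_intersection_rep
      (\<lambda>S. \<exists>a y. S = {a..a + 1} \<times> {y}) (\<lambda>S. \<exists>x b. S = {x} \<times> {b..b + 1}) G H V S"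
    using rep by (simp add: unit_grid_intersection_rep_iff)
  then have HV: "H \<union> V = verts G"
    by (simp add: bipartite_intersection_rep_def bipartition_def)
  from bip have "\<forall>u\<in>H. \<exists>a y. S u = {a..a + 1} \<times> {y}" "\<forall>v\<in>V. \<exists>x b. S v = {x} \<times> {b..b + 1}"
    by (auto simp: bipartite_intersection_rep_def)
  then obtain a y x b where SH: "\<And>u. u \<in> H \<Longrightarrow> S u = {a u..a u + 1} \<times> {y u}"
    and SV: "\<And>v. v \<in> V \<Longrightarrow> S v = {x v} \<times> {b v..b v + 1}"
    by metis
  have a: "c1 < a u" "a u < c1 + \<epsilon>" if "u \<in> H" for u
  proof -
    have "(a u, y u) \<in> S u" "(a u + 1, y u) \<in> S u"
      using SH[OF that] by auto
    with sq HV that have "(a u, y u) \<in> open_square c (1 + \<epsilon>)" "(a u + 1, y u) \<in> open_square c (1 + \<epsilon>)"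
      by blast+
    then show "c1 < a u" "a u < c1 + \<epsilon>"
      by (auto simp: open_square_def c)
  qed
  have b: "c2 < b v" "b v < c2 + \<epsilon>" if "v \<in> V" for v
  proof -
    have "(x v, b v) \<in> S v" "(x v, b v + 1) \<in> S v"
      using SV[OF that] by auto
    with sq HV that have "(x v, b v) \<in> open_square c (1 + \<epsilon>)" "(x v, b v + 1) \<in> open_square c (1 + \<epsilon>)"
      by blast+
    then show "c2 < b v" "b v < c2 + \<epsilon>"
      by (auto simp: open_square_def c)
  qed
  \<comment> \<open>Left ends lie strictly between \<open>c1\<close> and
    \<open>c1 + \<epsilon>\<close>, right ends strictly between \<open>c1 + 1\<close> and
    \<open>c1 + 1 + \<epsilon>\<close>. An abscissa up to \<open>c1 + 1\<close> is therefore left of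
    every right end, and a larger one is right of every left end. Ordinates behave alike.\<close>
  define d where "d v \<longleftrightarrow> x v \<le> c1 + 1" for v
  define e where "e u \<longleftrightarrow> y u \<le> c2 + 1" for u
  have "order_rep G H V a (\<lambda>v. if d v then x v else x v - 1) d (\<lambda>u. if e u then y u else y u - 1) b e"
    unfolding order_rep_def
  proof (intro ballI)
    fix u v assume uv: "u \<in> H" "v \<in> V"
    have "u \<rightarrow>\<^bsub>G\<^esub> v \<longleftrightarrow> S u \<inter> S v \<noteq> {}"
      using bip uv by (simp add: bipartite_intersection_rep_def)
    also have "\<dots> \<longleftrightarrow> (a u \<le> x v \<and> x v \<le> a u + 1) \<and> (b v \<le> y u \<and> y u \<le> b v + 1)"
      by (auto simp: SH SV uv Times_Int_Times)
    also have "a u \<le> x v \<and> x v \<le> a u + 1 \<longleftrightarrow> dir_le (d v) (a u) (if d v then x v else x v - 1)"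
      using a[OF uv(1)] \<open>\<epsilon> < 1\<close> by (auto simp: dir_le_def d_def)
    also have "b v \<le> y u \<and> y u \<le> b v + 1 \<longleftrightarrow> dir_le (e u) (b v) (if e u then y u else y u - 1)"
      using b[OF uv(2)] \<open>\<epsilon> < 1\<close> by (auto simp: dir_le_def e_def)
    finally show "u \<rightarrow>\<^bsub>G\<^esub> v \<longleftrightarrow> dir_le (d v) (a u) (if d v then x v else x v - 1)
        \<and> dir_le (e u) (b v) (if e u then y u else y u - 1)" .
  qed
  then show ?thesis
    by blast
qed

lemma unit_grid_intersection_rep_if_order_rep:
  assumes ord: "order_rep G H V a x d y b e" and bip: "bipartition G H V"
    and fin: "finite (verts G)" and \<epsilon>: "0 < \<epsilon>" "\<epsilon> < 1"
  shows "\<exists>S c. unit_grid_intersection_rep G H V S \<and> (\<forall>v\<in>verts G. S v \<subseteq> open_square c (1 + \<epsilon>))"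
proof -
  have HV: "verts G = H \<union> V" "H \<inter> V = {}"
    using bip by (auto simp: bipartition_def)
  with fin have "finite H" "finite V"
    by auto
  with ord \<epsilon>(1) obtain a x y b where ord: "order_rep G H V a x d y b e"
    and inj: "inj_on x V" "inj_on y H"
    and rng: "a \<in> H \<rightarrow> {0<..<\<epsilon>}" "x \<in> V \<rightarrow> {0<..<\<epsilon>}" "y \<in> H \<rightarrow> {0<..<\<epsilon>}" "b \<in> V \<rightarrow> {0<..<\<epsilon>}"
    by (metis order_rep_general_position)
  have rH: "0 < a u" "a u < \<epsilon>" "0 < y u" "y u < \<epsilon>" if "u \<in> H" for u
    using rng that by (auto simp: Pi_iff)
  have rV: "0 < b v" "b v < \<epsilon>" "0 < x v" "x v < \<epsilon>" if "v \<in> V" for v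
    using rng that by (auto simp: Pi_iff)
  \<comment> \<open>Adding 1 turns the comparison with the left end into one with the right end.
    Since \<epsilon> < 1, shifted values exceed all unshifted ones, so no new coincidences arise and
    injectivity passes from \<open>x\<close> and \<open>y\<close> to \<open>X\<close> and
    \<open>Y\<close>.\<close>
  define X where "X v = (if d v then x v else x v + 1)" for v
  define Y where "Y u = (if e u then y u else y u + 1)" for u
  define S where "S w = (if w \<in> H then {a w..a w + 1} \<times> {Y w} else {X w} \<times> {b w..b w + 1})" for w
  have SH: "S u = {a u..a u + 1} \<times> {Y u}" if "u \<in> H" for u
    using that by (simp add: S_def)
  have SV: "S v = {X v} \<times> {b v..b v + 1}" if "v \<in> V" for v
    using that HV by (auto simp: S_def)
  have injX: "v = v'" if "X v = X v'" "v \<in> V" "v' \<in> V" for v v'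
    using that inj(1) rV[of v] rV[of v'] \<epsilon> by (auto simp: X_def inj_on_def split: if_splits)
  have injY: "u = u'" if "Y u = Y u'" "u \<in> H" "u' \<in> H" for u u'
    using that inj(2) rH[of u] rH[of u'] \<epsilon> by (auto simp: Y_def inj_on_def split: if_splits)
  have "unit_grid_intersection_rep G H V S"
    unfolding unit_grid_intersection_rep_iff bipartite_intersection_rep_def
  proof (intro conjI ballI bip)
    show "disjoint_family_on S H"
      using injY by (auto simp: disjoint_family_on_def SH)
    show "disjoint_family_on S V"
      using injX by (auto simp: disjoint_family_on_def SV)
    fix u v assume uv: "u \<in> H" "v \<in> V"
    have "S u \<inter> S v \<noteq> {} \<longleftrightarrow> (a u \<le> X v \<and> X v \<le> a u + 1) \<and> (b v \<le> Y u \<and> Y u \<le> b v + 1)"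
      by (auto simp: SH SV uv Times_Int_Times)
    also have "a u \<le> X v \<and> X v \<le> a u + 1 \<longleftrightarrow> dir_le (d v) (a u) (x v)"
      using rH[OF uv(1)] rV[OF uv(2)] \<epsilon> by (auto simp: dir_le_def X_def)
    also have "b v \<le> Y u \<and> Y u \<le> b v + 1 \<longleftrightarrow> dir_le (e u) (b v) (y u)"
      using rH[OF uv(1)] rV[OF uv(2)] \<epsilon> by (auto simp: dir_le_def Y_def)
    also have "dir_le (d v) (a u) (x v) \<and> dir_le (e u) (b v) (y u) \<longleftrightarrow> u \<rightarrow>\<^bsub>G\<^esub> v"
      using ord uv by (simp add: order_rep_def)
    finally show "S u \<inter> S v \<noteq> {} \<longleftrightarrow> u \<rightarrow>\<^bsub>G\<^esub> v" .
  qed (use SH SV in blast)+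
  moreover have "S w \<subseteq> open_square (0, 0) (1 + \<epsilon>)" if "w \<in> verts G" for w
  proof (cases "w \<in> H")
    case True
    then show ?thesis
      using rH[OF True] by (auto simp: SH open_square_def Y_def)
  next
    case False
    with that HV have w: "w \<in> V"
      by blast
    then show ?thesis
      using rV[OF w] by (auto simp: SV open_square_def X_def)
  qed
  ultimately show ?thesis
    by blast
qed

section \<open>Rays versus order representations\<close>

lemma order_rep_if_ray_rep:
  assumes rep: "bipartite_intersection_rep horizontal_ray vertical_ray G H V S"
  shows "\<exists>a x d y b e. order_rep G H V a x d y b e"
proof -
  \<comment> \<open>The flag is true for rays pointing left or, in the vertical case, down: the ray
    then contains the coordinates up to its end point.\<close>
  have "\<forall>u\<in>H. \<exists>a y e. S u = (if e then {..y} else {y..}) \<times> {a}"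
    using rep unfolding bipartite_intersection_rep_def horizontal_ray_def by metis
  then obtain a y e where SH: "\<And>u. u \<in> H \<Longrightarrow> S u = (if e u then {..y u} else {y u..}) \<times> {a u}"
    by metis
  have "\<forall>v\<in>V. \<exists>b x d. S v = {b} \<times> (if d then {..x} else {x..})"
    using rep unfolding bipartite_intersection_rep_def vertical_ray_def by metis
  then obtain b x d where SV: "\<And>v. v \<in> V \<Longrightarrow> S v = {b v} \<times> (if d v then {..x v} else {x v..})"
    by metis
  have "order_rep G H V a x d y b e"
    unfolding order_rep_def
  proof (intro ballI)
    fix u v assume uv: "u \<in> H" "v \<in> V"
    have "u \<rightarrow>\<^bsub>G\<^esub> v \<longleftrightarrow> S u \<inter> S v \<noteq> {}"
      using rep uv by (simp add: bipartite_intersection_rep_def)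
    also have "\<dots> \<longleftrightarrow> dir_le (d v) (a u) (x v) \<and> dir_le (e u) (b v) (y u)"
      by (auto simp: SH SV uv dir_le_def)
    finally show "u \<rightarrow>\<^bsub>G\<^esub> v \<longleftrightarrow> dir_le (d v) (a u) (x v) \<and> dir_le (e u) (b v) (y u)" .
  qed
  then show ?thesis
    by blast
qed

lemma ray_rep_if_order_rep:
  assumes ord: "order_rep G H V a x d y b e" and bip: "bipartition G H V"
    and fin: "finite (verts G)"
  shows "\<exists>S. bipartite_intersection_rep horizontal_ray vertical_ray G H V S"
proof -
  have HV: "verts G = H \<union> V" "H \<inter> V = {}"
    using bip by (auto simp: bipartition_def)
  with fin have "finite H" "finite V"
    by auto
  \<comment> \<open>Here \<open>a\<close> and \<open>b\<close> fix the supporting lines, so their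
    injectivity puts the rays of each class on distinct parallel lines. The interval width 1 is an
    arbitrary choice.\<close>
  with ord obtain a x y b where ord: "order_rep G H V a x d y b e"
    and inj: "inj_on a H" "inj_on b V"
    by (metis order_rep_general_position zero_less_one)
  define S where "S w = (if w \<in> H then (if e w then {..y w} else {y w..}) \<times> {a w}
    else {b w} \<times> (if d w then {..x w} else {x w..}))" for w
  have SH: "S u = (if e u then {..y u} else {y u..}) \<times> {a u}" if "u \<in> H" for u
    using that by (simp add: S_def)
  have SV: "S v = {b v} \<times> (if d v then {..x v} else {x v..})" if "v \<in> V" for v
    using that HV by (auto simp: S_def)
  have "bipartite_intersection_rep horizontal_ray vertical_ray G H V S"
    unfolding bipartite_intersection_rep_def
  proof (intro conjI ballI bip)
    show "disjoint_family_on S H"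
      using inj(1) by (auto simp: disjoint_family_on_def SH inj_on_def)
    show "disjoint_family_on S V"
      using inj(2) by (auto simp: disjoint_family_on_def SV inj_on_def)
    show "horizontal_ray (S u)" if "u \<in> H" for u
      using SH[OF that] by (auto simp: horizontal_ray_def)
    show "vertical_ray (S v)" if "v \<in> V" for v
      using SV[OF that] by (auto simp: vertical_ray_def)
    show "S u \<inter> S v \<noteq> {} \<longleftrightarrow> u \<rightarrow>\<^bsub>G\<^esub> v" if "u \<in> H" "v \<in> V" for u v
      using ord that by (auto simp: order_rep_def SH SV dir_le_def)
  qed
  then show ?thesis
    by blast
qed

theorem theorem1:
  fixes G :: "('a, 'b) pre_digraph" and \<epsilon> :: real
  assumes "0 < \<epsilon>" and "\<epsilon> < 1" and "graph G"
  shows "(\<exists>H V S c. unit_grid_intersection_rep G H V S \<and>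
                    (\<forall>v\<in>verts G. S v \<subseteq> open_square c (1 + \<epsilon>)))
         \<longleftrightarrow> orthogonal_ray_graph G"
proof -
  interpret graph G
    by (rule assms)
  have fin: "finite (verts G)"
    by simp
  show ?thesis
  proof
    assume "\<exists>H V S c. unit_grid_intersection_rep G H V S \<and>
      (\<forall>v\<in>verts G. S v \<subseteq> open_square c (1 + \<epsilon>))"
    then obtain H V S c where rep: "unit_grid_intersection_rep G H V S"
      "\<forall>v\<in>verts G. S v \<subseteq> open_square c (1 + \<epsilon>)"
      by blast
    \<comment> \<open>An order representation speaks only of pairs from \<open>H\<close> and
      \<open>V\<close>, so the absence of arcs inside a class is carried over separately.\<close>
    then have "bipartition G H V"
      by (simp add: unit_grid_intersection_rep_iff bipartite_intersection_rep_def)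
    moreover obtain a x d y b e where "order_rep G H V a x d y b e"
      using order_rep_if_unit_grid_intersection_rep[OF rep(1) assms(2) rep(2)] by blast
    ultimately show "orthogonal_ray_graph G"
      using ray_rep_if_order_rep fin unfolding orthogonal_ray_graph_def by blast
  next
    assume "orthogonal_ray_graph G"
    then obtain H V S where rep: "bipartite_intersection_rep horizontal_ray vertical_ray G H V S"
      by (auto simp: orthogonal_ray_graph_def)
    then have "bipartition G H V"
      by (simp add: bipartite_intersection_rep_def)
    moreover obtain a x d y b e where "order_rep G H V a x d y b e"
      using order_rep_if_ray_rep[OF rep] by blast
    ultimately show "\<exists>H V S c. unit_grid_intersection_rep G H V S \<and>
      (\<forall>v\<in>verts G. S v \<subseteq> open_square c (1 + \<epsilon>))"
      using unit_grid_intersection_rep_if_order_rep fin assms(1,2) by blast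
  qed
qed

end
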